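(* Let $R$ be an infinite commutative ring, not necessarily with identity. Then every nonzero polynomial in $R[x]$ has only finitely many roots in $R$ if and only if $R$ has no nonzero zero divisors.
   Context: A root of $F(x)\in R[x]$ is an element $r\in R$ with $F(r)=0$. A nonzero zero divisor is a nonzero element $a\in R$ for which there is a nonzero $b\in R$ with $ab=0$. *)

theory Defs
  imports "HOL-Computational_Algebra.Polynomial"
begin

text \<open>
  The class \<^class>\<open>comm_ring\<close> does not require a multiplicative identity. Neither
  does \<^const>\<open>poly\<close>, whose value at \<open>x\<close> is computed by Horner's scheme, so
  a constant polynomial evaluates to its coefficient even if the ring has no identity.
\<close>

definition nonzero_zero_divisor :: "'a::comm_ring \<Rightarrow> bool" where
  "nonzero_zero_divisor a \<longleftrightarrow> a \<noteq> 0 \<and> (\<exists>b. b \<noteq> 0 \<and> a * b = 0)"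

end

theory Submission
  imports Defs
begin

text \<open>
  Suppose first that \<open>a * b = 0\<close> with \<open>a\<close> and \<open>b\<close> nonzero. Multiplication by \<open>a\<close> is an additive
  endomorphism of the infinite group \<open>R\<close>, so its kernel and its image cannot both be finite. If the
  kernel is infinite, the linear polynomial \<open>a x\<close> has infinitely many roots. If the image is infinite,
  then \<open>b x\<close> does, because \<open>b\<close> annihilates every multiple of \<open>a\<close>.

  Conversely, the classical bound on the number of roots needs no identity: although \<open>x - c\<close> need not be a
  polynomial over \<open>R\<close>, synthetic division by it still makes sense, and for nonconstant \<open>F\<close> gives
  a nonzero \<open>G\<close> of smaller degree with \<open>F(x) - F(c) = (x - c) G(x)\<close> for all \<open>x\<close>. Without zero divisors,
  every root of \<open>F\<close> other than a given root \<open>c\<close> is a root of \<open>G\<close>, and induction on the degree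
  applies.
\<close>

text \<open>The fibres of multiplication by \<open>a\<close> are translates of the annihilator of \<open>a\<close>.\<close>

lemma infinite_range_mult_if_finite_annihilator:
  fixes a :: "'a::comm_ring"
  assumes "infinite (UNIV :: 'a set)" and "finite {r. a * r = 0}"
  shows "infinite (range (\<lambda>r. a * r))"
proof
  assume "finite (range (\<lambda>r. a * r))"
  then obtain s where s: "infinite ((\<lambda>r. a * r) -` {a * s})"
    using inf_img_fin_dom[OF _ assms(1)] by blast
  have "(\<lambda>r. a * r) -` {a * s} \<subseteq> (\<lambda>r. s + r) ` {r. a * r = 0}"
  proof
    fix t assume "t \<in> (\<lambda>r. a * r) -` {a * s}"
    then have "a * (t - s) = 0" by (simp add: right_diff_distrib)
    moreover have "t = s + (t - s)" by simp
    ultimately show "t \<in> (\<lambda>r. s + r) ` {r. a * r = 0}" by blast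
  qed
  with s assms(2) show False by (meson finite_imageI finite_subset)
qed

lemma linear_poly_infinite_roots_if_zero_divisor:
  fixes a b :: "'a::comm_ring"
  assumes "infinite (UNIV :: 'a set)" and "a \<noteq> 0" and "b \<noteq> 0" and "a * b = 0"
  obtains F :: "'a poly" where "F \<noteq> 0" and "infinite {r. poly F r = 0}"
proof (cases "finite {r. a * r = 0}")
  case False
  then have "infinite {r. poly [:0, a:] r = 0}" by (simp add: mult.commute)
  with \<open>a \<noteq> 0\<close> show ?thesis by (intro that[of "[:0, a:]"]) auto
next
  case True
  have "range (\<lambda>r. a * r) \<subseteq> {r. poly [:0, b:] r = 0}"
  proof clarify
    fix r
    have "a * r * b = a * b * r" by (simp only: ac_simps)
    then show "poly [:0, b:] (a * r) = 0" using \<open>a * b = 0\<close> by simp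
  qed
  then have "infinite {r. poly [:0, b:] r = 0}"
    using infinite_range_mult_if_finite_annihilator[OF assms(1) True] finite_subset by blast
  with \<open>b \<noteq> 0\<close> show ?thesis by (intro that[of "[:0, b:]"]) auto
qed

text \<open>
  Horner's scheme computes the quotient using only sums and products of the coefficients and \<open>c\<close>.
  The factor theorem therefore survives without an identity once it is stated for values, where
  \<open>x - c\<close> is a ring element and no monic linear polynomial has to be formed.
\<close>

lemma poly_diff_eq_mult_synthetic_div:
  fixes p :: "'a::comm_ring poly"
  shows "poly p x - poly p c = (x - c) * poly (synthetic_div p c) x"
proof -
  have "poly p x + c * poly (synthetic_div p c) x = poly p c + x * poly (synthetic_div p c) x"
    using arg_cong[OF synthetic_div_correct[of p c], of "\<lambda>q. poly q x"] by simp
  then show ?thesis by (simp add: algebra_simps)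
qed

lemma finite_roots_if_no_zero_divisors:
  fixes p :: "'a::comm_ring poly"
  assumes no_zero_divisors: "\<And>a b :: 'a. a * b = 0 \<Longrightarrow> a = 0 \<or> b = 0" and "p \<noteq> 0"
  shows "finite {r. poly p r = 0}"
  using \<open>p \<noteq> 0\<close>
proof (induction "degree p" arbitrary: p rule: less_induct)
  case less
  show ?case
  proof (cases "\<exists>c. poly p c = 0")
    case False
    then show ?thesis by simp
  next
    case True
    then obtain c where c: "poly p c = 0" by blast
    \<comment> \<open>A nonzero constant has no root, so the quotient is nonzero and of smaller degree.\<close>
    have "degree p \<noteq> 0"
    proof
      assume "degree p = 0"
      then obtain k where "p = [:k:]" by (rule degree_eq_zeroE)
      with c less.prems show False by simp
    qed
    then have "synthetic_div p c \<noteq> 0" and "degree (synthetic_div p c) < degree p"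
      by (simp_all add: synthetic_div_eq_0_iff degree_synthetic_div)
    then have "finite {r. poly (synthetic_div p c) r = 0}" using less.hyps by blast
    moreover have "{r. poly p r = 0} \<subseteq> insert c {r. poly (synthetic_div p c) r = 0}"
    proof
      fix r assume "r \<in> {r. poly p r = 0}"
      with c have "(r - c) * poly (synthetic_div p c) r = 0"
        using poly_diff_eq_mult_synthetic_div[of p r c] by simp
      then show "r \<in> insert c {r. poly (synthetic_div p c) r = 0}"
        using no_zero_divisors by fastforce
    qed
    ultimately show ?thesis by (meson finite_insert finite_subset)
  qed
qed

theorem theorem3:
  assumes "infinite (UNIV :: 'a::comm_ring set)"
  shows "(\<forall>F :: 'a poly. F \<noteq> 0 \<longrightarrow> finite {r. poly F r = 0}) \<longleftrightarrow>
         \<not> (\<exists>a :: 'a. nonzero_zero_divisor a)"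
proof
  assume finite_roots: "\<forall>F :: 'a poly. F \<noteq> 0 \<longrightarrow> finite {r. poly F r = 0}"
  show "\<not> (\<exists>a :: 'a. nonzero_zero_divisor a)"
  proof
    assume "\<exists>a :: 'a. nonzero_zero_divisor a"
    then obtain a b :: 'a where "a \<noteq> 0" "b \<noteq> 0" "a * b = 0"
      unfolding nonzero_zero_divisor_def by blast
    with assms obtain F :: "'a poly" where "F \<noteq> 0" "infinite {r. poly F r = 0}"
      by (rule linear_poly_infinite_roots_if_zero_divisor)
    with finite_roots show False by blast
  qed
next
  assume "\<not> (\<exists>a :: 'a. nonzero_zero_divisor a)"
  then have "\<And>a b :: 'a. a * b = 0 \<Longrightarrow> a = 0 \<or> b = 0"
    unfolding nonzero_zero_divisor_def by blast
  then show "\<forall>F :: 'a poly. F \<noteq> 0 \<longrightarrow> finite {r. poly F r = 0}"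
    using finite_roots_if_no_zero_divisors by blast
qed

end
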